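(* Let $q, b, \lambda$ be indeterminates. For a positive integer $n$ and an integer $s$ with $0\le s\le n+1$, let $$g_n(s):=\sum_{k=0}^{\infty} \frac{q^{k^2+sk}\lambda^k}{(q;q)_k\,(-bq^s;q)_k}\cdot\frac{(q;q)_{n-k-s+1}}{(q;q)_{n-2k-s+1}}\cdot\frac{(-bq;q)_{n-k}}{(-bq;q)_n},$$ where every term with $n-2k-s+1<0$ is zero, so that the sum runs over $0\le k\le \lfloor (n-s+1)/2\rfloor$. Then, for every $n=1,2,3,\dots$, $$(1+b)\frac{g_n(0)}{g_n(1)} = 1+b+\cfrac{\lambda q}{1+bq+\cfrac{\lambda q^2}{1+bq^2+\cfrac{\lambda q^3}{1+bq^3+\cdots+\cfrac{\lambda q^n}{1+bq^n}}}}$$ as an identity of rational functions in $q,b,\lambda$ (and hence for all complex values of $q,b,\lambda$ for which all denominators occurring are nonzero).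
   Context: The $q$-rising factorial is defined for integers $k\ge 0$ by $(a;q)_0:=1$ and $(a;q)_k:=(1-a)(1-aq)\cdots(1-aq^{k-1})$ for $k>0$. The convention $1/(q;q)_m=0$ for $m=-1,-2,-3,\dots$ is used, so the terms of $g_n(s)$ with $n-2k-s+1<0$ are taken to be $0$ and $g_n(s)$ is a finite sum. The continued fraction on the right-hand side is the finite one with partial numerators $\lambda q^j$ and partial denominators $1+bq^j$ for $j=1,\dots,n$, and leading term $1+b$; for $n=1$ it is $1+b+\frac{\lambda q}{1+bq}$. *)

theory Defs
  imports Complex_Main "HOL-Computational_Algebra.Polynomial_Factorial"
begin

definition qpoch :: "'a::field \<Rightarrow> 'a \<Rightarrow> nat \<Rightarrow> 'a" where
  "qpoch a q k = (\<Prod>i<k. 1 - a * q ^ i)"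

text \<open>
  For \<open>s \<le> n + 1\<close> the natural-number subtractions below are exact: \<open>k\<close> is restricted to
  \<open>2 * k \<le> n + 1 - s\<close>, the range in which \<open>n - 2 * k - s + 1\<close> is nonnegative (all other
  terms vanish by the convention \<open>1 / (q; q)\<^sub>m = 0\<close> for \<open>m < 0\<close>), and \<open>k \<le> n\<close> there when \<open>n \<ge> 1\<close>.
\<close>

definition g :: "'a::field \<Rightarrow> 'a \<Rightarrow> 'a \<Rightarrow> nat \<Rightarrow> nat \<Rightarrow> 'a" where
  "g q b lam n s =
     (\<Sum>k = 0..(n + 1 - s) div 2.
        (q ^ (k ^ 2 + s * k) * lam ^ k) / (qpoch q q k * qpoch (- b * q ^ s) q k)
        * (qpoch q q (n + 1 - s - k) / qpoch q q (n + 1 - s - 2 * k))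
        * (qpoch (- b * q) q (n - k) / qpoch (- b * q) q n))"

text \<open>
  \<open>cfrac u v j m\<close> is the finite continued fraction
  \<open>v j + u (j+1) / (v (j+1) + u (j+2) / (\<dots> + u (j+m) / v (j+m)))\<close>.
\<close>

fun cfrac :: "(nat \<Rightarrow> 'a::field) \<Rightarrow> (nat \<Rightarrow> 'a) \<Rightarrow> nat \<Rightarrow> nat \<Rightarrow> 'a" where
  "cfrac u v j 0 = v j"
| "cfrac u v j (Suc m) = v j + u (Suc j) / cfrac u v (Suc j) m"

abbreviation cf :: "'a::field \<Rightarrow> 'a \<Rightarrow> 'a \<Rightarrow> nat \<Rightarrow> nat \<Rightarrow> 'a" where
  "cf q b lam \<equiv> cfrac (\<lambda>j. lam * q ^ j) (\<lambda>j. 1 + b * q ^ j)"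

text \<open>
  Since \<open>x / 0 = 0\<close> in HOL, an identity between quotients is meaningful only together with the
  nonvanishing of every denominator: those in the terms of \<open>g\<close> for \<open>s = 0, 1\<close>, the denominator
  \<open>g q b lam n 1\<close>, and the denominators \<open>cf q b lam j (n - j)\<close> at each level of the continued
  fraction.
\<close>

definition denominators_nonzero :: "'a::field \<Rightarrow> 'a \<Rightarrow> 'a \<Rightarrow> nat \<Rightarrow> bool" where
  "denominators_nonzero q b lam n \<longleftrightarrow>
     (\<forall>s\<in>{0, 1}. \<forall>k\<in>{0..(n + 1 - s) div 2}.
        qpoch q q k \<noteq> 0 \<and> qpoch (- b * q ^ s) q k \<noteq> 0 \<and> qpoch q q (n + 1 - s - 2 * k) \<noteq> 0)
     \<and> qpoch (- b * q) q n \<noteq> 0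
     \<and> g q b lam n 1 \<noteq> 0
     \<and> (\<forall>j\<in>{1..n}. cf q b lam j (n - j) \<noteq> 0)"

text \<open>
  The field of rational functions over the complex numbers in three indeterminates, as the fraction
  field of \<open>\<complex>[q][b][\<lambda>]\<close>: the innermost polynomial variable is \<open>q\<close>, the outermost is \<open>\<lambda>\<close>.
\<close>

type_synonym ratfun = "complex poly poly poly fract"

definition q_var :: ratfun where
  "q_var = to_fract [:[:[:0, 1:]:]:]"

definition b_var :: ratfun where
  "b_var = to_fract [:[:0, 1:]:]"

definition lam_var :: ratfun where
  "lam_var = to_fract [:0, 1:]"

end

theory Submission
  imports Defs
begin

text \<open>
  A finite continued fraction is a quotient of two continuants: \<open>cfrac u v j m\<close> is
  \<open>K\<^sub>j / K\<^sub>j\<^sub>+\<^sub>1\<close>, where \<open>K\<^sub>i\<close> is the continuant of the levels \<open>i, \<dots>, j + m\<close>, a polynomial in the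
  partial numerators and denominators that satisfies
  \<open>K\<^sub>i = v\<^sub>i K\<^sub>i\<^sub>+\<^sub>1 + u\<^sub>i\<^sub>+\<^sub>1 K\<^sub>i\<^sub>+\<^sub>2\<close>. The theorem therefore amounts to a closed form for the continuants
  of \<open>u\<^sub>j = \<lambda>q\<^sup>j\<close> and \<open>v\<^sub>j = 1 + bq\<^sup>j\<close>.

  That closed form is \<open>\<Sum>\<^sub>k q^(k^2 + sk) \<lambda>\<^sup>k [m-k, k] (-bq^(s+k); q)\<^sub>m\<^sub>-\<^sub>2\<^sub>k\<close> for the levels
  \<open>s, \<dots>, s + m - 1\<close>, where \<open>[m-k, k]\<close> is a Gaussian binomial coefficient (\<open>continuant_closed_form\<close>).
  To see that it obeys the recurrence, compare coefficients of \<open>\<lambda>\<^sup>k\<close> and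
  cancel the common \<open>q\<close>-factorials; what remains is an identity that is linear in \<open>b\<close>. Its constant
  coefficient and its coefficient of \<open>b\<close> are the two forms of the \<open>q\<close>-Pascal rule.
  Written as a quotient of \<open>q\<close>-factorials, the closed form is
  \<open>(-bq\<^sup>s; q)\<^sub>n\<^sub>+\<^sub>1\<^sub>-\<^sub>s g\<^sub>n(s)\<close> (\<open>qpoch_mult_g\<close>). The factors for \<open>s = 0\<close> and \<open>s = 1\<close> have quotient \<open>1 + b\<close>,
  which gives the identity wherever the denominators do not vanish.

  For indeterminates no denominator vanishes: each \<open>q\<close>-factorial and each continuant is a polynomial
  that takes the value 1 at \<open>q = b = \<lambda> = 0\<close>.
\<close>

section \<open>Continuants and continued fractions\<close>

text \<open>
  The last argument counts the levels, so the empty continuant is 1 and \<open>cfrac u v j m\<close>, which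
  has levels \<open>j, \<dots>, j + m\<close>, has the numerator \<open>continuant u v j (Suc m)\<close>.
\<close>

fun continuant :: "(nat \<Rightarrow> 'a::comm_ring_1) \<Rightarrow> (nat \<Rightarrow> 'a) \<Rightarrow> nat \<Rightarrow> nat \<Rightarrow> 'a" where
  "continuant u v j 0 = 1"
| "continuant u v j (Suc 0) = v j"
| "continuant u v j (Suc (Suc m)) =
     v j * continuant u v (Suc j) (Suc m) + u (Suc j) * continuant u v (Suc (Suc j)) m"

text \<open>
  Stated without division, so that only the denominators inside the continued fraction have to be
  nonzero, not the continuants.
\<close>

lemma cfrac_mult_continuant:
  assumes "\<And>i. i < m \<Longrightarrow> cfrac u v (j + m - i) i \<noteq> 0"
  shows "cfrac u v j m * continuant u v (Suc j) m = continuant u v j (Suc m)"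
  using assms
proof (induction m arbitrary: j)
  case 0
  show ?case by simp
next
  case (Suc m)
  have ne: "cfrac u v (Suc j) m \<noteq> 0"
    using Suc.prems[of m] by simp
  have IH: "cfrac u v (Suc j) m * continuant u v (Suc (Suc j)) m = continuant u v (Suc j) (Suc m)"
  proof (rule Suc.IH)
    show "cfrac u v (Suc j + m - i) i \<noteq> 0" if "i < m" for i
      using Suc.prems[of i] that by simp
  qed
  have "u (Suc j) / cfrac u v (Suc j) m * continuant u v (Suc j) (Suc m)
      = u (Suc j) * continuant u v (Suc (Suc j)) m"
    using ne by (simp add: IH[symmetric])
  then show ?case by (simp add: distrib_right)
qed

lemma cfrac_nonzero:
  assumes "\<And>j m. continuant u v j m \<noteq> 0"
  shows "cfrac u v j m \<noteq> 0"
proof (induction m arbitrary: j rule: less_induct)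
  case (less m)
  have "cfrac u v j m * continuant u v (Suc j) m = continuant u v j (Suc m)"
    using less.IH by (rule cfrac_mult_continuant)
  with assms show ?case by (metis mult_zero_left)
qed

section \<open>Gaussian binomial coefficients\<close>

text \<open>
  A recursive definition makes sense when \<open>q\<close> is a root of unity and gives 0 above the diagonal,
  which removes the boundary cases from the coefficient comparison below.
\<close>

fun qbinom :: "'a::comm_ring_1 \<Rightarrow> nat \<Rightarrow> nat \<Rightarrow> 'a" where
  "qbinom q N 0 = 1"
| "qbinom q 0 (Suc k) = 0"
| "qbinom q (Suc N) (Suc k) = q ^ Suc k * qbinom q N (Suc k) + qbinom q N k"

lemma qbinom_eq_0: "N < k \<Longrightarrow> qbinom q N k = 0"
  by (induction q N k rule: qbinom.induct) auto

lemma qbinom_self: "qbinom q N N = 1"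
  by (induction N) (auto simp: qbinom_eq_0)

text \<open>
  The \<open>q\<close>-Pascal rule dual to the defining one. In the induction step each rule is applied to the
  result of the other, and both orders give the same combination of entries in row \<open>N\<close>.
\<close>

lemma qbinom_Suc_Suc':
  "k \<le> N \<Longrightarrow> qbinom q (Suc N) (Suc k) = qbinom q N (Suc k) + q ^ (N - k) * qbinom q N k"
proof (induction N arbitrary: k)
  case 0
  then show ?case by simp
next
  case (Suc N)
  show ?case
  proof (cases "k = Suc N")
    case True
    then show ?thesis by (simp add: qbinom_eq_0 qbinom_self del: qbinom.simps(3))
  next
    case False
    with Suc.prems have k: "k \<le> N" by simp
    note up = Suc.IH[OF k]
    show ?thesis
    proof (cases k)
      case 0
      then show ?thesis using up by (simp add: algebra_simps)
    next
      case (Suc l)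
      then have l: "l < N" using k by simp
      have low: "qbinom q (Suc N) (Suc l) = qbinom q N (Suc l) + q ^ (N - l) * qbinom q N l"
        using l by (intro Suc.IH) simp
      have "qbinom q (Suc (Suc N)) (Suc k)
          = q ^ Suc k * (qbinom q N (Suc k) + q ^ (N - k) * qbinom q N k)
            + (qbinom q N k + q ^ (N - l) * qbinom q N l)"
        using up low Suc by (simp only: qbinom.simps(3))
      also have "\<dots> = q ^ Suc k * qbinom q N (Suc k) + qbinom q N k
            + q ^ (N - l) * (q ^ k * qbinom q N k + qbinom q N l)"
      proof -
        have "q ^ Suc k * q ^ (N - k) = q ^ (N - l) * q ^ k"
          using Suc l by (simp flip: power_add power_Suc)
        then have "q ^ Suc k * (q ^ (N - k) * qbinom q N k) = q ^ (N - l) * (q ^ k * qbinom q N k)"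
          by (metis mult.assoc)
        then show ?thesis by (simp only: distrib_left ac_simps)
      qed
      also have "\<dots> = qbinom q (Suc N) (Suc k) + q ^ (Suc N - k) * qbinom q (Suc N) k"
        using Suc by simp
      finally show ?thesis .
    qed
  qed
qed

lemma qpoch_0 [simp]: "qpoch a q 0 = 1"
  by (simp add: qpoch_def)

lemma qpoch_Suc: "qpoch a q (Suc k) = qpoch a q k * (1 - a * q ^ k)"
  by (simp add: qpoch_def)

lemma qpoch_add: "qpoch a q (i + j) = qpoch a q i * qpoch (a * q ^ i) q j"
  by (induction j) (simp_all add: qpoch_Suc power_add mult.assoc)

lemma qpoch_Suc_left: "qpoch a q (Suc k) = (1 - a) * qpoch (a * q) q k"
  using qpoch_add[of a q 1 k] by (simp add: qpoch_Suc)

text \<open>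
  The product formula in the form without division, hence valid for every \<open>q\<close>. The \<open>q\<close>-Pascal rule
  reduces it to \<open>1 - q^(i+j) = q\<^sup>i (1 - q\<^sup>j) + (1 - q\<^sup>i)\<close>.
\<close>

lemma qbinom_mult_qpoch:
  "qbinom q (i + j) i * (qpoch q q i * qpoch q q j) = qpoch q q (i + j)"
proof (induction "i + j" arbitrary: i j)
  case 0
  then show ?case by simp
next
  case (Suc N)
  consider "i = 0" | "j = 0" | i' j' where "i = Suc i'" "j = Suc j'"
    by (metis not0_implies_Suc)
  then show ?case
  proof cases
    case 3
    have N: "N = i' + Suc j'" "N = Suc i' + j'" using Suc.hyps(2) 3 by simp_all
    have *: "qbinom q N i' * (qpoch q q i' * qpoch q q (Suc j')) = qpoch q q N"
      using Suc.hyps(1)[OF N(1)] N(1) by simp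
    have **: "qbinom q N (Suc i') * (qpoch q q (Suc i') * qpoch q q j') = qpoch q q N"
      using Suc.hyps(1)[OF N(2)] N(2) by simp
    have "qbinom q (i + j) i * (qpoch q q i * qpoch q q j)
        = q ^ i * (1 - q ^ j) * (qbinom q N (Suc i') * (qpoch q q (Suc i') * qpoch q q j'))
          + (1 - q ^ i) * (qbinom q N i' * (qpoch q q i' * qpoch q q (Suc j')))"
      using 3 N(1) by (simp add: qpoch_Suc algebra_simps)
    also have "\<dots> = (1 - q ^ (i + j)) * qpoch q q N"
      unfolding * ** by (simp add: algebra_simps power_add)
    also have "\<dots> = qpoch q q (i + j)"
      using 3 N(1) by (simp add: qpoch_Suc algebra_simps)
    finally show ?thesis .
  qed (simp_all add: qbinom_self)
qed

section \<open>Closed form of the continuants\<close>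

definition continuant_term :: "'a::field \<Rightarrow> 'a \<Rightarrow> 'a \<Rightarrow> nat \<Rightarrow> nat \<Rightarrow> nat \<Rightarrow> 'a" where
  "continuant_term q b lam s m k =
     q ^ (k ^ 2 + s * k) * lam ^ k * qbinom q (m - k) k * qpoch (- b * q ^ (s + k)) q (m - 2 * k)"

lemma continuant_term_eq_0: "m < 2 * k \<Longrightarrow> continuant_term q b lam s m k = 0"
  by (simp add: continuant_term_def qbinom_eq_0)

lemma continuant_term_0_rec:
  "continuant_term q b lam s (Suc m) 0 = (1 + b * q ^ s) * continuant_term q b lam (Suc s) m 0"
  by (simp add: continuant_term_def qpoch_Suc_left mult.assoc mult.commute[of "q ^ s" q])

text \<open>
  After cancellation, with \<open>N = m + 1 - k\<close>, the claim reads
  \<open>(1 + bq^(s+k+1)) [N, k+1] = (1 + bq\<^sup>s) q^(k+1) [N-1, k+1] + (1 + bq^(s+N)) [N-1, k]\<close>.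
  The coefficients of 1 and of \<open>b\<close> are the two \<open>q\<close>-Pascal rules.
\<close>

lemma continuant_term_Suc_rec:
  "continuant_term q b lam s (Suc (Suc m)) (Suc k) =
     (1 + b * q ^ s) * continuant_term q b lam (Suc s) (Suc m) (Suc k)
     + lam * q ^ Suc s * continuant_term q b lam (Suc (Suc s)) m k"
proof (cases "m < 2 * k")
  case True
  then show ?thesis by (simp add: continuant_term_eq_0)
next
  case False
  define d where "d = m - 2 * k"
  with False have m: "m = 2 * k + d" by simp
  define A where "A = qbinom q (k + d) (Suc k)"
  define B where "B = qbinom q (k + d) k"
  define E where "E = q ^ (Suc k ^ 2 + s * Suc k) * lam ^ Suc k"
  define x where "x = - b * q ^ (s + Suc k)"
  have pascal: "qbinom q (Suc (k + d)) (Suc k) = q ^ Suc k * A + B"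
    by (simp add: A_def B_def)
  have pascal': "qbinom q (Suc (k + d)) (Suc k) = A + q ^ d * B"
    using qbinom_Suc_Suc'[of k "k + d" q] by (simp add: A_def B_def)
  have idx: "Suc (Suc m) - Suc k = Suc (k + d)" "Suc (Suc m) - 2 * Suc k = d"
      "Suc m - Suc k = k + d" "Suc m - 2 * Suc k = d - 1" "m - k = k + d" "m - 2 * k = d"
    by (simp_all add: m)
  have lhs: "continuant_term q b lam s (Suc (Suc m)) (Suc k)
      = E * qbinom q (Suc (k + d)) (Suc k) * qpoch x q d"
    unfolding continuant_term_def idx E_def x_def ..
  have r1: "continuant_term q b lam (Suc s) (Suc m) (Suc k)
      = E * q ^ Suc k * A * qpoch (x * q) q (d - 1)"
    unfolding continuant_term_def idx E_def x_def A_def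
    by (simp add: algebra_simps power_add power2_eq_square)
  have "q ^ Suc s * q ^ (k ^ 2 + Suc (Suc s) * k) = q ^ (Suc k ^ 2 + s * Suc k)"
    by (simp only: power_add[symmetric]) (simp add: power2_eq_square algebra_simps)
  then have r2: "lam * q ^ Suc s * continuant_term q b lam (Suc (Suc s)) m k
      = E * B * qpoch (x * q) q d"
    unfolding continuant_term_def idx E_def x_def B_def
    by (simp add: algebra_simps)
  show ?thesis
  proof (cases d)
    case 0
    then have "A = 0" by (simp add: A_def qbinom_eq_0)
    with 0 show ?thesis unfolding lhs r1 r2 pascal by simp
  next
    case (Suc e)
    define R where "R = qpoch (x * q) q e"
    have P: "qpoch x q d = (1 - x) * R" "qpoch (x * q) q (d - 1) = R"
        "qpoch (x * q) q d = R * (1 - x * q ^ d)"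
      unfolding R_def Suc by (simp_all add: qpoch_Suc_left[of x] qpoch_Suc[of "x * q"])
    have bx: "b * q ^ s * q ^ Suc k = - x"
      by (simp add: x_def power_add)
    have "qbinom q (Suc (k + d)) (Suc k) * (1 - x)
        = (q ^ Suc k * A + B) - x * (A + q ^ d * B)"
      using pascal pascal' by (simp add: algebra_simps)
    also have "\<dots> = (q ^ Suc k + b * q ^ s * q ^ Suc k) * A + B * (1 - x * q ^ d)"
      unfolding bx by (simp add: algebra_simps)
    finally have key: "qbinom q (Suc (k + d)) (Suc k) * (1 - x)
        = (1 + b * q ^ s) * q ^ Suc k * A + B * (1 - x * q ^ d)"
      by (simp add: algebra_simps)
    have "E * qbinom q (Suc (k + d)) (Suc k) * ((1 - x) * R)
        = E * R * (qbinom q (Suc (k + d)) (Suc k) * (1 - x))"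
      by (simp only: ac_simps)
    then show ?thesis
      unfolding lhs r1 r2 P key by (simp add: algebra_simps)
  qed
qed

text \<open>
  The summands vanish for \<open>2 * k > m\<close>. Leaving the upper limit free makes the three sums in the
  recurrence match term by term.
\<close>

lemma continuant_closed_form:
  assumes "m div 2 \<le> R"
  shows "continuant (\<lambda>j. lam * q ^ j) (\<lambda>j. 1 + b * q ^ j) s m
    = (\<Sum>k\<le>R. continuant_term q b lam s m k)"
  using assms
proof (induction m arbitrary: s R rule: less_induct)
  case (less m)
  have short: "(\<Sum>k\<le>R. continuant_term q b lam s m k) = continuant_term q b lam s m 0" if "m < 2"
  proof -
    have "(\<Sum>k\<le>R. continuant_term q b lam s m k) = (\<Sum>k\<in>{0}. continuant_term q b lam s m k)"
      using that by (intro sum.mono_neutral_right) (auto intro!: continuant_term_eq_0)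
    then show ?thesis by simp
  qed
  consider "m = 0" | "m = 1" | l where "m = Suc (Suc l)"
    by (metis One_nat_def not0_implies_Suc)
  then show ?case
  proof cases
    case 3
    with less.prems obtain R' where R: "R = Suc R'" "l div 2 \<le> R'"
      by (cases R) auto
    have "(\<Sum>k\<le>R. continuant_term q b lam s m k)
        = continuant_term q b lam s m 0 + (\<Sum>k\<le>R'. continuant_term q b lam s m (Suc k))"
      unfolding R by (rule sum.atMost_Suc_shift)
    also have "\<dots> = (1 + b * q ^ s) * (\<Sum>k\<le>R. continuant_term q b lam (Suc s) (Suc l) k)
        + lam * q ^ Suc s * (\<Sum>k\<le>R'. continuant_term q b lam (Suc (Suc s)) l k)"
      unfolding R sum.atMost_Suc_shift 3
      by (simp only: continuant_term_0_rec continuant_term_Suc_rec sum.distrib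
          sum_distrib_left[symmetric] distrib_left add.assoc)
    also have "\<dots> = continuant (\<lambda>j. lam * q ^ j) (\<lambda>j. 1 + b * q ^ j) s m"
      using less.IH[of "Suc l" R "Suc s"] less.IH[of l R' "Suc (Suc s)"] 3 R by simp
    finally show ?thesis ..
  qed (use short in \<open>simp_all add: continuant_term_def qpoch_Suc\<close>)
qed

text \<open>
  For \<open>s = 0\<close> and \<open>s = 1\<close> alike, \<open>(-bq\<^sup>s; q)\<^sub>n\<^sub>+\<^sub>1\<^sub>-\<^sub>s\<^sub>-\<^sub>j\<close> is a multiple of \<open>(-bq; q)\<^sub>n\<^sub>-\<^sub>j\<close> by a
  factor independent of \<open>j\<close>, namely \<open>1 + b\<close> or 1. Taking \<open>j = 0\<close> and \<open>j = k\<close> turns the last quotient in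
  \<open>g\<close> into the \<open>q\<close>-factorial of the closed form.
\<close>

lemma qpoch_mult_g:
  assumes "n \<ge> 1" "s \<in> {0, 1}"
    and nz: "\<And>k. k \<le> (n + 1 - s) div 2 \<Longrightarrow>
      qpoch q q k \<noteq> 0 \<and> qpoch (- b * q ^ s) q k \<noteq> 0 \<and> qpoch q q (n + 1 - s - 2 * k) \<noteq> 0"
    and nzn: "qpoch (- b * q) q n \<noteq> 0"
  shows "qpoch (- b * q ^ s) q (n + 1 - s) * g q b lam n s
    = continuant (\<lambda>j. lam * q ^ j) (\<lambda>j. 1 + b * q ^ j) s (n + 1 - s)"
proof -
  define M where "M = n + 1 - s"
  define c where "c = (if s = 0 then 1 + b else 1)"
  have shift: "qpoch (- b * q ^ s) q (M - j) = c * qpoch (- b * q) q (n - j)" if "j \<le> n" for j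
    using assms(2) that by (auto simp: M_def c_def qpoch_Suc_left Suc_diff_le)
  have "qpoch (- b * q ^ s) q M *
      ((q ^ (k ^ 2 + s * k) * lam ^ k) / (qpoch q q k * qpoch (- b * q ^ s) q k)
        * (qpoch q q (M - k) / qpoch q q (M - 2 * k))
        * (qpoch (- b * q) q (n - k) / qpoch (- b * q) q n))
      = continuant_term q b lam s M k" if k: "k \<le> M div 2" for k
  proof -
    have kn: "k \<le> n" "2 * k \<le> M" using k assms(1) by (auto simp: M_def)
    have split: "M - k = k + (M - 2 * k)" using kn by simp
    have nz': "qpoch q q k \<noteq> 0" "qpoch (- b * q ^ s) q k \<noteq> 0" "qpoch q q (M - 2 * k) \<noteq> 0"
      using nz[of k] k by (auto simp: M_def)
    have bin: "qpoch q q (M - k) = qbinom q (M - k) k * (qpoch q q k * qpoch q q (M - 2 * k))"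
      using qbinom_mult_qpoch[of q k "M - 2 * k"] unfolding split[symmetric] by simp
    have top: "qpoch (- b * q ^ s) q M = c * qpoch (- b * q) q n"
      using shift[of 0] by simp
    have "c * qpoch (- b * q) q (n - k)
        = qpoch (- b * q ^ s) q k * qpoch (- b * q ^ (s + k)) q (M - 2 * k)"
      using shift[OF kn(1)] qpoch_add[of "- b * q ^ s" q k "M - 2 * k"]
      unfolding split[symmetric] by (simp add: power_add mult.assoc)
    moreover have "c * D * (E / (A * B) * (N * (A * Z) / Z) * (D' / D)) = E * N * X"
      if "c * D' = B * X" "A \<noteq> 0" "B \<noteq> 0" "Z \<noteq> 0" "D \<noteq> 0" for A B D D' E N X Z :: 'a
    proof -
      have "c * D * (E / (A * B) * (N * (A * Z) / Z) * (D' / D)) = E * N * (c * D') / B"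
        using that(2-5) by simp
      then show ?thesis using that(1,3) by simp
    qed
    ultimately show ?thesis
      unfolding continuant_term_def bin top using nz' nzn by blast
  qed
  then have "qpoch (- b * q ^ s) q M * g q b lam n s = (\<Sum>k\<le>M div 2. continuant_term q b lam s M k)"
    unfolding g_def M_def[symmetric] sum_distrib_left atLeast0AtMost
    by (intro sum.cong) auto
  then show ?thesis
    using continuant_closed_form[of M "M div 2" lam q b s] by (simp add: M_def)
qed

text \<open>
  The continuants of the levels \<open>0, \<dots>, n\<close> and \<open>1, \<dots>, n\<close> are \<open>(-b; q)\<^sub>n\<^sub>+\<^sub>1 g\<^sub>n(0)\<close> and
  \<open>(-bq; q)\<^sub>n g\<^sub>n(1)\<close>; the two \<open>q\<close>-factorials differ exactly by the factor \<open>1 + b\<close>.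
\<close>

lemma g_quotient_eq_cf:
  fixes q b lam :: "'a::field"
  assumes "n \<ge> 1" and nz: "denominators_nonzero q b lam n"
  shows "(1 + b) * (g q b lam n 0 / g q b lam n 1) = cf q b lam 0 n"
proof -
  let ?K = "continuant (\<lambda>j. lam * q ^ j) (\<lambda>j. 1 + b * q ^ j)"
  define D where "D = qpoch (- b * q) q n"
  have D: "D \<noteq> 0" and g1: "g q b lam n 1 \<noteq> 0"
    using nz by (auto simp: denominators_nonzero_def D_def)
  have "qpoch (- b * q ^ 0) q (n + 1 - 0) * g q b lam n 0 = ?K 0 (n + 1 - 0)"
    by (rule qpoch_mult_g) (use assms in \<open>auto simp: denominators_nonzero_def\<close>)
  then have K0: "(1 + b) * D * g q b lam n 0 = ?K 0 (Suc n)"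
    by (simp add: qpoch_Suc_left D_def)
  have "qpoch (- b * q ^ 1) q (n + 1 - 1) * g q b lam n 1 = ?K 1 (n + 1 - 1)"
    by (rule qpoch_mult_g) (use assms in \<open>auto simp: denominators_nonzero_def\<close>)
  then have K1: "D * g q b lam n 1 = ?K (Suc 0) n"
    by (simp add: D_def)
  have "cf q b lam 0 n * ?K (Suc 0) n = ?K 0 (Suc n)"
  proof (rule cfrac_mult_continuant)
    fix i assume "i < n"
    then have "n - i \<in> {1..n}" "n - (n - i) = i" by auto
    then show "cf q b lam (0 + n - i) i \<noteq> 0"
      using nz unfolding denominators_nonzero_def by (metis add_0)
  qed
  then have "D * (cf q b lam 0 n * g q b lam n 1) = D * ((1 + b) * g q b lam n 0)"
    unfolding K0[symmetric] K1[symmetric] by (simp only: ac_simps)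
  with D have "cf q b lam 0 n * g q b lam n 1 = (1 + b) * g q b lam n 0"
    by (simp only: mult_cancel_left) simp
  with g1 show ?thesis by (simp add: divide_eq_eq)
qed

section \<open>Nonvanishing for indeterminates\<close>

text \<open>
  A rational function represented by a polynomial is nonzero as soon as that polynomial has a nonzero
  value at the origin, and such values are compatible with sums and products.
\<close>

definition origin_value :: "ratfun \<Rightarrow> complex \<Rightarrow> bool" where
  "origin_value x c \<longleftrightarrow> (\<exists>p. x = to_fract p \<and> poly (poly (poly p 0) 0) 0 = c)"

lemma origin_value_nonzero: "origin_value x 1 \<Longrightarrow> x \<noteq> 0"
  by (auto simp: origin_value_def)

lemma origin_value_1: "origin_value 1 1"
  by (auto simp: origin_value_def intro!: exI[of _ 1])

lemma origin_value_vars: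
  "origin_value q_var 0" "origin_value b_var 0" "origin_value lam_var 0"
  by (auto simp: origin_value_def q_var_def b_var_def lam_var_def)

lemma origin_value_add: "origin_value x c \<Longrightarrow> origin_value y d \<Longrightarrow> origin_value (x + y) (c + d)"
  unfolding origin_value_def
  by (metis poly_add to_fract_add)

lemma origin_value_diff: "origin_value x c \<Longrightarrow> origin_value y d \<Longrightarrow> origin_value (x - y) (c - d)"
  unfolding origin_value_def
  by (metis poly_diff to_fract_diff)

lemma origin_value_mult: "origin_value x c \<Longrightarrow> origin_value y d \<Longrightarrow> origin_value (x * y) (c * d)"
  unfolding origin_value_def
  by (metis poly_mult to_fract_mult)

lemma origin_value_power: "origin_value x c \<Longrightarrow> origin_value (x ^ k) (c ^ k)"
  by (induction k) (auto intro: origin_value_1 origin_value_mult)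

lemma origin_value_mult_q_power:
  assumes "origin_value x 0"
  shows "origin_value (x * q_var ^ i) 0"
  using origin_value_mult[OF assms origin_value_power[OF origin_value_vars(1)], of i] by simp

lemma qpoch_ratfun_nonzero:
  assumes "origin_value a 0"
  shows "qpoch a q_var k \<noteq> 0"
proof -
  have "origin_value (qpoch a q_var k) 1"
  proof (induction k)
    case (Suc k)
    show ?case
      using origin_value_mult[OF Suc
          origin_value_diff[OF origin_value_1 origin_value_mult_q_power[OF assms]]]
      by (simp add: qpoch_Suc)
  qed (simp add: origin_value_1)
  then show ?thesis by (rule origin_value_nonzero)
qed

lemma continuant_ratfun_nonzero:
  "continuant (\<lambda>j. lam_var * q_var ^ j) (\<lambda>j. 1 + b_var * q_var ^ j) j m \<noteq> 0"
proof -
  let ?u = "\<lambda>j. lam_var * q_var ^ j" and ?v = "\<lambda>j. 1 + b_var * q_var ^ j"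
  have v: "origin_value (?v i) 1" for i
    using origin_value_add[OF origin_value_1 origin_value_mult_q_power[OF origin_value_vars(2)]]
    by simp
  have u: "origin_value (?u i) 0" for i
    by (rule origin_value_mult_q_power[OF origin_value_vars(3)])
  have "origin_value (continuant ?u ?v j m) 1"
  proof (induction ?u ?v j m rule: continuant.induct)
    case (3 j m)
    show ?case
      using origin_value_add[OF origin_value_mult[OF v[of j] 3(1)]
          origin_value_mult[OF u[of "Suc j"] 3(2)]]
      by simp
  qed (use v in \<open>simp_all add: origin_value_1\<close>)
  then show ?thesis by (rule origin_value_nonzero)
qed

lemma denominators_nonzero_ratfun:
  assumes "n \<ge> 1"
  shows "denominators_nonzero q_var b_var lam_var n"
proof -
  have "origin_value (- b_var) 0"
    using origin_value_diff[OF origin_value_diff[OF origin_value_1 origin_value_1] origin_value_vars(2)]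
    by simp
  then have b: "qpoch (- b_var * q_var ^ s) q_var k \<noteq> 0" for s k
    by (intro qpoch_ratfun_nonzero origin_value_mult_q_power)
  have b1: "qpoch (- b_var * q_var) q_var k \<noteq> 0" for k
    using b[of 1] by simp
  have q: "qpoch q_var q_var k \<noteq> 0" for k
    by (intro qpoch_ratfun_nonzero origin_value_vars)
  have "qpoch (- b_var * q_var ^ 1) q_var (n + 1 - 1) * g q_var b_var lam_var n 1
      = continuant (\<lambda>j. lam_var * q_var ^ j) (\<lambda>j. 1 + b_var * q_var ^ j) 1 (n + 1 - 1)"
    by (rule qpoch_mult_g[OF assms _ _ b1]) (use b q in blast)+
  then have "g q_var b_var lam_var n 1 \<noteq> 0"
    using continuant_ratfun_nonzero[of 1 "n + 1 - 1"] by auto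
  moreover have "cf q_var b_var lam_var j m \<noteq> 0" for j m
    by (rule cfrac_nonzero) (rule continuant_ratfun_nonzero)
  ultimately show ?thesis
    unfolding denominators_nonzero_def using b b1 q by blast
qed

section \<open>The continued fraction identity\<close>

theorem theorem1p4:
  fixes n :: nat
  assumes "n \<ge> 1"
  shows "denominators_nonzero q_var b_var lam_var n \<and>
         (1 + b_var) * (g q_var b_var lam_var n 0 / g q_var b_var lam_var n 1)
           = cf q_var b_var lam_var 0 n \<and>
         (\<forall>q b lam :: complex. denominators_nonzero q b lam n \<longrightarrow>
           (1 + b) * (g q b lam n 0 / g q b lam n 1) = cf q b lam 0 n)"
  by (intro conjI allI impI denominators_nonzero_ratfun g_quotient_eq_cf assms)

end
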